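(* There exists a symbol $a\in W(\mathcal{F}L^\infty,L^1)(\mathbb{R}^{2d})$ such that the corresponding Kohn–Nirenberg operator $\operatorname{Op}_0(a)$ and anti-Kohn–Nirenberg operator $\operatorname{Op}_1(a)$ are not bounded on $L^2(\mathbb{R}^d)$.
   Context: $\langle\cdot,\cdot\rangle$ is the $L^2$ inner product or the duality pairing between $\mathcal{S}'$ and $\mathcal{S}$ (antilinear in the second argument). For a fixed nonzero window $\Phi\in\mathcal{S}(\mathbb{R}^{2d})$ and $a\in\mathcal{S}'(\mathbb{R}^{2d})$, the short-time Fourier transform is $V_\Phi a(z,\zeta)=\int_{\mathbb{R}^{2d}}a(t)\overline{\Phi(t-z)}e^{-2\pi it\zeta}\,dt$ (in the distributional sense). $W(\mathcal{F}L^\infty,L^1)(\mathbb{R}^{2d})$ is the space of $a\in\mathcal{S}'(\mathbb{R}^{2d})$ with $\int_{\mathbb{R}^{2d}}\sup_{\zeta}|V_\Phi a(z,\zeta)|\,dz<\infty$ (independent of the window). For $\tau\in[0,1]$, $W_\tau(f,g)(x,\xi)=\int_{\mathbb{R}^d}e^{-2\pi it\xi}f(x+\tau t)\overline{g(x-(1-\tau)t)}\,dt$, and for $a\in\mathcal{S}'(\mathbb{R}^{2d})$ the operator $\operatorname{Op}_\tau(a):\mathcal{S}(\mathbb{R}^d)\to\mathcal{S}'(\mathbb{R}^d)$ is defined by $\langle\operatorname{Op}_\tau(a)f,g\rangle=\langle a,W_\tau(g,f)\rangle$, $f,g\in\mathcal{S}(\mathbb{R}^d)$; formally $\operatorname{Op}_\tau(a)f(x)=\iint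 e^{2\pi i(x-y)\xi}a((1-\tau)x+\tau y,\xi)f(y)\,dy\,d\xi$. In particular $\operatorname{Op}_0(a)f(x)=\int_{\mathbb{R}^d}a(x,\xi)\hat f(\xi)e^{2\pi ix\xi}\,d\xi$ with $\hat f(\xi)=\int e^{-2\pi ix\xi}f(x)\,dx$. "Not bounded on $L^2(\mathbb{R}^d)$" means that the operator does not extend from $\mathcal{S}(\mathbb{R}^d)$ to a bounded operator $L^2(\mathbb{R}^d)\to L^2(\mathbb{R}^d)$. *)

theory Defs
  imports "HOL-Analysis.Analysis"
begin

fun iter_partial :: "'a::euclidean_space list \<Rightarrow> ('a \<Rightarrow> complex) \<Rightarrow> 'a \<Rightarrow> complex" where
  "iter_partial [] f = f"
| "iter_partial (b # bs) f = (\<lambda>x. frechet_derivative (iter_partial bs f) (at x) b)"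

definition smooth_fun :: "('a::euclidean_space \<Rightarrow> complex) \<Rightarrow> bool" where
  "smooth_fun f \<longleftrightarrow> (\<forall>bs \<in> lists Basis. \<forall>x. iter_partial bs f differentiable (at x))"

definition schwartz :: "('a::euclidean_space \<Rightarrow> complex) set" where
  "schwartz = {f. smooth_fun f \<and>
     (\<forall>k. \<forall>bs \<in> lists Basis. bounded (range (\<lambda>x. norm x ^ k *\<^sub>R iter_partial bs f x)))}"

definition schwartz_seminorm :: "nat \<Rightarrow> 'a::euclidean_space list \<Rightarrow> ('a \<Rightarrow> complex) \<Rightarrow> real" where
  "schwartz_seminorm k bs f = (SUP x. norm x ^ k * norm (iter_partial bs f x))"

definition schwartz_topology :: "('a::euclidean_space \<Rightarrow> complex) topology" where
  "schwartz_topology = topology_generated_by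
     {{g \<in> schwartz. schwartz_seminorm k bs (\<lambda>x. g x - f x) < e} | f k bs e.
        f \<in> schwartz \<and> bs \<in> lists Basis \<and> e > 0}"

text \<open>Tempered distributions are linear functionals, so that \<open>a \<phi>\<close> stands for
  the formal integral of \<open>a(t) \<phi>(t)\<close>. Only the values on Schwartz functions matter.
  The sesquilinear pairing is obtained by conjugating the test function.\<close>

definition tempered_distributions :: "(('a::euclidean_space \<Rightarrow> complex) \<Rightarrow> complex) set" where
  "tempered_distributions = {a.
     (\<forall>f \<in> schwartz. \<forall>g \<in> schwartz. a (\<lambda>x. f x + g x) = a f + a g) \<and>
     (\<forall>c. \<forall>f \<in> schwartz. a (\<lambda>x. c * f x) = c * a f) \<and>
     continuous_map schwartz_topology euclidean a}"

definition dual_pairing :: "(('a::euclidean_space \<Rightarrow> complex) \<Rightarrow> complex) \<Rightarrow> ('a \<Rightarrow> complex) \<Rightarrow> complex" where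
  "dual_pairing a f = a (\<lambda>x. cnj (f x))"

definition STFT ::
  "('a::euclidean_space \<Rightarrow> complex) \<Rightarrow> (('a \<Rightarrow> complex) \<Rightarrow> complex) \<Rightarrow> 'a \<Rightarrow> 'a \<Rightarrow> complex" where
  "STFT \<Phi> a z \<zeta> = a (\<lambda>t. cnj (\<Phi> (t - z)) * cis (- 2 * pi * (t \<bullet> \<zeta>)))"

definition W_FLinf_L1 ::
  "('a::euclidean_space \<Rightarrow> complex) \<Rightarrow> (('a \<Rightarrow> complex) \<Rightarrow> complex) set" where
  "W_FLinf_L1 \<Phi> = {a \<in> tempered_distributions.
     (\<integral>\<^sup>+ z. (SUP \<zeta>. ennreal (norm (STFT \<Phi> a z \<zeta>))) \<partial>lborel) < \<infinity>}"

definition tau_Wigner ::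
  "real \<Rightarrow> ('a::euclidean_space \<Rightarrow> complex) \<Rightarrow> ('a \<Rightarrow> complex) \<Rightarrow> 'a \<times> 'a \<Rightarrow> complex" where
  "tau_Wigner \<tau> f g = (\<lambda>(x, \<xi>).
     LINT t|lborel. cis (- 2 * pi * (t \<bullet> \<xi>)) * f (x + \<tau> *\<^sub>R t) * cnj (g (x - (1 - \<tau>) *\<^sub>R t)))"

definition Op ::
  "real \<Rightarrow> (('a::euclidean_space \<times> 'a \<Rightarrow> complex) \<Rightarrow> complex) \<Rightarrow>
     ('a \<Rightarrow> complex) \<Rightarrow> ('a \<Rightarrow> complex) \<Rightarrow> complex" where
  "Op \<tau> a f = (\<lambda>h. dual_pairing a (tau_Wigner \<tau> (\<lambda>x. cnj (h x)) f))"

lemma dual_pairing_Op: "dual_pairing (Op \<tau> a f) g = dual_pairing a (tau_Wigner \<tau> g f)"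
  by (simp add: dual_pairing_def Op_def)

definition L2_fun :: "('a::euclidean_space \<Rightarrow> complex) set" where
  "L2_fun = {f \<in> borel_measurable lborel. integrable lborel (\<lambda>x. (norm (f x))\<^sup>2)}"

definition L2_norm :: "('a::euclidean_space \<Rightarrow> complex) \<Rightarrow> real" where
  "L2_norm f = sqrt (LINT x|lborel. (norm (f x))\<^sup>2)"

text \<open>Operators act on representatives, hence linearity is required almost everywhere;
  together with the norm bound this makes \<open>T\<close> well defined on classes modulo null sets.\<close>

definition bounded_L2_operator ::
  "(('a::euclidean_space \<Rightarrow> complex) \<Rightarrow> 'a \<Rightarrow> complex) \<Rightarrow> bool" where
  "bounded_L2_operator T \<longleftrightarrow>
     (\<forall>f \<in> L2_fun. T f \<in> L2_fun) \<and>
     (\<forall>f \<in> L2_fun. \<forall>g \<in> L2_fun. AE x in lborel. T (\<lambda>y. f y + g y) x = T f x + T g x) \<and>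
     (\<forall>c. \<forall>f \<in> L2_fun. AE x in lborel. T (\<lambda>y. c * f y) x = c * T f x) \<and>
     (\<exists>C. \<forall>f \<in> L2_fun. L2_norm (T f) \<le> C * L2_norm f)"

definition bounded_on_L2 ::
  "(('a::euclidean_space \<Rightarrow> complex) \<Rightarrow> ('a \<Rightarrow> complex) \<Rightarrow> complex) \<Rightarrow> bool" where
  "bounded_on_L2 A \<longleftrightarrow> (\<exists>T. bounded_L2_operator T \<and>
     (\<forall>f \<in> schwartz. \<forall>g \<in> schwartz. dual_pairing (A f) g = (LINT x|lborel. T f x * cnj (g x))))"

end

theory Submission
  imports Defs "HOL-Probability.Sinc_Integral"
begin

text \<open>The symbol is the Dirac distribution at the origin. Its short-time Fourier transform is
  \<open>cnj (\<Phi> (- z))\<close>, independent of the frequency \<open>\<zeta>\<close> and integrable in \<open>z\<close>. On the operator side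
  \<open>Op\<^sub>0(\<delta>) f = (\<integral> f) \<delta>\<close> and \<open>Op\<^sub>1(\<delta>) f = f(0) \<cdot> 1\<close>, so both forms are products of the integral of
  one argument with the point value of the other. Point evaluation is unbounded in \<open>L\<^sup>2\<close>:
  the Gaussians \<open>exp (- n \<bar>x\<bar>\<^sup>2)\<close> take the value 1 at the origin while their norms tend to 0.\<close>

section \<open>Gaussians as Schwartz functions\<close>

definition gauss :: "real \<Rightarrow> 'a::euclidean_space \<Rightarrow> complex" where
  "gauss c x = of_real (exp (- c * (x \<bullet> x)))"

lemma gauss_0 [simp]: "gauss c 0 = 1"
  by (simp add: gauss_def)

lemma gauss_minus [simp]: "gauss c (- x) = gauss c x"
  by (simp add: gauss_def)

lemma cnj_gauss [simp]: "cnj (gauss c x) = gauss c x"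
  by (simp add: gauss_def)

text \<open>Polynomials with real coefficients times a fixed Gaussian. Generating them from linear
  forms \<open>x \<bullet> b\<close> lets closure under derivatives and decay be proved by rule
  induction.\<close>

inductive_set poly_gauss :: "real \<Rightarrow> ('a::euclidean_space \<Rightarrow> complex) set" for c :: real where
  gauss: "gauss c \<in> poly_gauss c"
| inner: "f \<in> poly_gauss c \<Longrightarrow> (\<lambda>x. of_real (x \<bullet> b) * f x) \<in> poly_gauss c"
| scale: "f \<in> poly_gauss c \<Longrightarrow> (\<lambda>x. of_real r * f x) \<in> poly_gauss c"
| add: "f \<in> poly_gauss c \<Longrightarrow> g \<in> poly_gauss c \<Longrightarrow> (\<lambda>x. f x + g x) \<in> poly_gauss c"

text \<open>Differentiating the Gaussian produces a linear factor, and the product rule for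
  \<open>inner\<close> returns \<open>f\<close> itself next to its derivative, so every directional
  derivative stays in the class. Existence and closure are proved together because the induction
  needs both.\<close>

lemma poly_gauss_has_derivative:
  assumes "f \<in> poly_gauss c"
  shows "\<exists>D. (\<forall>x. (f has_derivative D x) (at x)) \<and> (\<forall>b. (\<lambda>x. D x b) \<in> poly_gauss c)"
  using assms
proof induction
  case gauss
  let ?D = "\<lambda>x h::'a. of_real (- 2 * c) * (of_real (x \<bullet> h) * gauss c x)"
  have "(gauss c has_derivative ?D x) (at x)" for x :: 'a
    unfolding gauss_def [abs_def]
    by (auto intro!: derivative_eq_intros simp: inner_commute algebra_simps)
  moreover have "(\<lambda>x. ?D x b) \<in> poly_gauss c" for b
    by (intro poly_gauss.intros)
  ultimately show ?case
    by (intro exI [of _ ?D]) blast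
next
  case (inner f e)
  then obtain D where D: "\<And>x. (f has_derivative D x) (at x)" "\<And>b. (\<lambda>x. D x b) \<in> poly_gauss c"
    by blast
  let ?D = "\<lambda>x h. of_real (x \<bullet> e) * D x h + of_real (h \<bullet> e) * f x"
  have "((\<lambda>x. of_real (x \<bullet> e) * f x) has_derivative ?D x) (at x)" for x
    by (auto intro!: derivative_eq_intros D)
  moreover have "(\<lambda>x. ?D x b) \<in> poly_gauss c" for b
    by (intro poly_gauss.intros D inner.hyps)
  ultimately show ?case
    by (intro exI [of _ ?D]) blast
next
  case (scale f r)
  then obtain D where D: "\<And>x. (f has_derivative D x) (at x)" "\<And>b. (\<lambda>x. D x b) \<in> poly_gauss c"
    by blast
  let ?D = "\<lambda>x h. of_real r * D x h"
  have "((\<lambda>x. of_real r * f x) has_derivative ?D x) (at x)" for x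
    by (auto intro!: derivative_eq_intros D)
  moreover have "(\<lambda>x. ?D x b) \<in> poly_gauss c" for b
    by (intro poly_gauss.intros D)
  ultimately show ?case
    by (intro exI [of _ ?D]) blast
next
  case (add f g)
  then obtain D E where D: "\<And>x. (f has_derivative D x) (at x)" "\<And>b. (\<lambda>x. D x b) \<in> poly_gauss c"
    and E: "\<And>x. (g has_derivative E x) (at x)" "\<And>b. (\<lambda>x. E x b) \<in> poly_gauss c"
    by blast
  let ?D = "\<lambda>x h. D x h + E x h"
  have "((\<lambda>x. f x + g x) has_derivative ?D x) (at x)" for x
    by (auto intro!: derivative_eq_intros D E)
  moreover have "(\<lambda>x. ?D x b) \<in> poly_gauss c" for b
    by (intro poly_gauss.intros D E)
  ultimately show ?case
    by (intro exI [of _ ?D]) blast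
qed

lemma iter_partial_poly_gauss:
  assumes "f \<in> poly_gauss c"
  shows "iter_partial bs f \<in> poly_gauss c"
proof (induction bs)
  case Nil
  then show ?case
    using assms by simp
next
  case (Cons b bs)
  obtain D where D: "\<And>x. (iter_partial bs f has_derivative D x) (at x)"
      "(\<lambda>x. D x b) \<in> poly_gauss c"
    using poly_gauss_has_derivative [OF Cons.IH] by blast
  \<comment> \<open>\<open>frechet_derivative\<close> is defined by choice; uniqueness of the
    derivative identifies it with \<open>D\<close>.\<close>
  have "frechet_derivative (iter_partial bs f) (at x) = D x" for x
    using D(1) by (metis frechet_derivative_at)
  with D(2) show ?case
    by simp
qed

lemma pow_times_gauss_bounded:
  assumes "c > 0"
  shows "\<exists>B. \<forall>x. norm x ^ k * norm (gauss c x) \<le> B"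
proof (intro exI allI)
  fix x :: 'a
  define y where "y = c * (norm x)\<^sup>2"
  have y: "y \<ge> 0"
    using assms by (simp add: y_def)
  \<comment> \<open>A single term of the exponential series, all of whose terms are nonnegative as
    \<open>y \<ge> 0\<close>.\<close>
  have 1: "y ^ k / fact k \<le> exp y"
  proof -
    have "(\<Sum>n\<in>{k}. y ^ n /\<^sub>R fact n) \<le> exp y"
      unfolding exp_def using y summable_exp_generic [of y] by (intro sum_le_suminf) auto
    then show ?thesis
      by (simp add: field_simps)
  qed
  \<comment> \<open>Squaring makes the power of the norm even, so that it becomes a power of
    \<open>y\<close>, also for odd \<open>k\<close>.\<close>
  have "norm x ^ k \<le> 1 + (norm x ^ k)\<^sup>2"
    using sum_squares_bound [of "norm x ^ k" 1] zero_le_power [OF norm_ge_zero, of x k]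
    unfolding mult_1_right power_one by linarith
  also have "(norm x ^ k)\<^sup>2 = y ^ k / c ^ k"
    using assms by (simp add: y_def power_mult_distrib power_mult [symmetric] mult.commute)
  also have "y ^ k / c ^ k \<le> fact k / c ^ k * exp y"
    using 1 assms by (simp add: field_simps)
  also have "1 + fact k / c ^ k * exp y \<le> (1 + fact k / c ^ k) * exp y"
    using y by (simp add: algebra_simps)
  finally have "norm x ^ k * exp (- y) \<le> (1 + fact k / c ^ k) * exp y * exp (- y)"
    by (intro mult_right_mono) auto
  also have "\<dots> = 1 + fact k / c ^ k"
    by (simp add: exp_minus)
  finally show "norm x ^ k * norm (gauss c x) \<le> 1 + fact k / c ^ k"
    by (simp add: gauss_def y_def dot_square_norm)
qed

text \<open>By Cauchy-Schwarz a factor \<open>x \<bullet> b\<close> costs one more power of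
  \<open>norm x\<close>, hence the induction is over all \<open>k\<close> at once.\<close>

lemma pow_times_poly_gauss_bounded:
  assumes "f \<in> poly_gauss c" and "c > 0"
  shows "\<exists>B. \<forall>x. norm x ^ k * norm (f x) \<le> B"
  using assms(1)
proof (induction arbitrary: k)
  case gauss
  then show ?case
    using assms(2) by (rule pow_times_gauss_bounded)
next
  case (inner f b)
  obtain B where B: "norm x ^ Suc k * norm (f x) \<le> B" for x
    using inner.IH by blast
  have "norm x ^ k * norm (of_real (x \<bullet> b) * f x) \<le> norm b * B" for x
  proof -
    have "norm x ^ k * norm (of_real (x \<bullet> b) * f x) \<le> norm x ^ k * ((norm x * norm b) * norm (f x))"
      by (auto simp: norm_mult Cauchy_Schwarz_ineq2 intro!: mult_left_mono mult_right_mono)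
    also have "\<dots> = norm b * (norm x ^ Suc k * norm (f x))"
      by (simp add: algebra_simps)
    also have "\<dots> \<le> norm b * B"
      using B by (intro mult_left_mono) auto
    finally show ?thesis .
  qed
  then show ?case
    by blast
next
  case (scale f r)
  obtain B where B: "norm x ^ k * norm (f x) \<le> B" for x
    using scale.IH by blast
  have "norm x ^ k * norm (of_real r * f x) \<le> \<bar>r\<bar> * B" for x
    using mult_left_mono [OF B [of x], of "\<bar>r\<bar>"] by (simp add: norm_mult algebra_simps)
  then show ?case
    by blast
next
  case (add f g)
  obtain B C where "norm x ^ k * norm (f x) \<le> B" "norm x ^ k * norm (g x) \<le> C" for x
    using add.IH by meson
  moreover have "norm x ^ k * norm (f x + g x) \<le> norm x ^ k * norm (f x) + norm x ^ k * norm (g x)"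
    for x
    using mult_left_mono [OF norm_triangle_ineq [of "f x" "g x"], of "norm x ^ k"]
    by (simp add: algebra_simps)
  ultimately have "norm x ^ k * norm (f x + g x) \<le> B + C" for x
    by (meson add_mono order_trans)
  then show ?case
    by blast
qed

lemma gauss_schwartz:
  assumes "c > 0"
  shows "gauss c \<in> schwartz"
proof -
  have *: "iter_partial bs (gauss c) \<in> poly_gauss c" for bs :: "'a list"
    by (intro iter_partial_poly_gauss poly_gauss.gauss)
  have "iter_partial bs (gauss c) differentiable (at x)" for x :: 'a and bs
    using poly_gauss_has_derivative [OF * [of bs]] unfolding differentiable_def by blast
  moreover have "bounded (range (\<lambda>x::'a. norm x ^ k *\<^sub>R iter_partial bs (gauss c) x))" for k bs
    using pow_times_poly_gauss_bounded [OF * [of bs] assms, of k]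
    by (auto simp: bounded_iff)
  ultimately show ?thesis
    by (auto simp: schwartz_def smooth_fun_def)
qed

section \<open>Integrability of Schwartz functions\<close>

text \<open>This weight serves as the integrable majorant because it factors over the coordinates:
  its integral is a power of the one-dimensional integral of
  \<open>inverse (1 + x\<^sup>2)\<close>.\<close>

lemma nn_integral_prod_inverse_finite:
  "(\<integral>\<^sup>+ x. ennreal (\<Prod>b\<in>Basis. inverse (1 + ((x::'a::euclidean_space) \<bullet> b)\<^sup>2)) \<partial>lborel) < \<infinity>"
proof -
  have fin: "(\<integral>\<^sup>+ x. ennreal (inverse (1 + (x::real)\<^sup>2)) \<partial>lborel) < \<infinity>"
    using integrable_inverse_1_plus_square
    by (simp add: set_integrable_def integrable_iff_bounded)
  have "(\<integral>\<^sup>+ x. ennreal (\<Prod>b\<in>Basis. inverse (1 + ((x::'a) \<bullet> b)\<^sup>2)) \<partial>lborel)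
      = (\<integral>\<^sup>+ x. (\<Prod>b\<in>Basis. ennreal (inverse (1 + ((x::'a) \<bullet> b)\<^sup>2))) \<partial>lborel)"
    by (intro nn_integral_cong prod_ennreal [symmetric]) simp
  also have "\<dots> = (\<Prod>b\<in>(Basis::'a set). \<integral>\<^sup>+ x. ennreal (inverse (1 + (x::real)\<^sup>2)) \<partial>lborel)"
    by (rule nn_integral_lborel_prod [where f = "\<lambda>_ x. ennreal (inverse (1 + x\<^sup>2))"]) auto
  also have "\<dots> < \<infinity>"
    using fin by (simp add: power_less_top_ennreal)
  finally show ?thesis .
qed

lemma prod_one_plus_square_le:
  fixes x :: "'a::euclidean_space"
  shows "(\<Prod>b\<in>Basis. 1 + (x \<bullet> b)\<^sup>2) \<le> 2 ^ DIM('a) * (1 + norm x ^ (2 * DIM('a)))"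
proof -
  have "(\<Prod>b\<in>Basis. 1 + (x \<bullet> b)\<^sup>2) \<le> (\<Prod>b\<in>(Basis::'a set). 1 + (norm x)\<^sup>2)"
    by (intro prod_mono) (auto simp: Basis_le_norm abs_le_square_iff [symmetric])
  also have "\<dots> = (1 + (norm x)\<^sup>2) ^ DIM('a)"
    by simp
  \<comment> \<open>A maximum, unlike a sum, commutes with powers, and is then bounded by the sum of
    its two entries.\<close>
  also have "\<dots> \<le> (2 * max 1 ((norm x)\<^sup>2)) ^ DIM('a)"
    by (intro power_mono) auto
  also have "\<dots> \<le> 2 ^ DIM('a) * (1 + norm x ^ (2 * DIM('a)))"
    by (auto simp: power_mult_distrib power_mult max_def)
  finally show ?thesis .
qed

lemma schwartz_pow_times_bounded:
  assumes "f \<in> schwartz"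
  shows "\<exists>B. \<forall>x. norm x ^ k * norm (f x) \<le> B"
proof -
  have "\<forall>bs \<in> lists Basis. bounded (range (\<lambda>x. norm x ^ k *\<^sub>R iter_partial bs f x))"
    using assms by (simp add: schwartz_def)
  then have "bounded (range (\<lambda>x. norm x ^ k *\<^sub>R f x))"
    by (auto dest: bspec [of _ _ "[]"])
  then show ?thesis
    by (auto simp: bounded_iff)
qed

text \<open>The reciprocal of the weight grows at most like \<open>norm x ^ (2 * DIM('a))\<close>,
  so the bounds for the powers 0 and \<open>2 * DIM('a)\<close> suffice.\<close>

lemma schwartz_decay:
  fixes f :: "'a::euclidean_space \<Rightarrow> complex"
  assumes "f \<in> schwartz"
  shows "\<exists>C\<ge>0. \<forall>x. norm (f x) \<le> C * (\<Prod>b\<in>Basis. inverse (1 + (x \<bullet> b)\<^sup>2))"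
proof -
  obtain A B where AB: "norm (f x) \<le> A" "norm x ^ (2 * DIM('a)) * norm (f x) \<le> B" for x
    using schwartz_pow_times_bounded [OF assms, of 0]
      schwartz_pow_times_bounded [OF assms, of "2 * DIM('a)"] by auto
  define C where "C = 2 ^ DIM('a) * (A + B)"
  have "norm (f x) \<le> C * (\<Prod>b\<in>Basis. inverse (1 + (x \<bullet> b)\<^sup>2))" for x
  proof -
    let ?P = "\<Prod>b\<in>Basis. 1 + (x \<bullet> b)\<^sup>2"
    have P: "?P > 0"
      by (intro prod_pos) (auto simp: add_pos_nonneg)
    have "?P * norm (f x) \<le> 2 ^ DIM('a) * (1 + norm x ^ (2 * DIM('a))) * norm (f x)"
      by (intro mult_right_mono prod_one_plus_square_le) auto
    also have "\<dots> = 2 ^ DIM('a) * (norm (f x) + norm x ^ (2 * DIM('a)) * norm (f x))"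
      by (simp add: algebra_simps)
    also have "\<dots> \<le> C"
      unfolding C_def using AB [of x] by (intro mult_left_mono add_mono) auto
    finally show ?thesis
      unfolding prod_inversef [unfolded o_def] using P by (simp add: field_simps)
  qed
  moreover have "C \<ge> 0"
    using AB [of 0] unfolding C_def
    by (intro mult_nonneg_nonneg add_nonneg_nonneg) (auto intro: order_trans [rotated])
  ultimately show ?thesis
    by blast
qed

lemma gauss_integrable:
  assumes "c > 0"
  shows "integrable lborel (gauss c :: 'a::euclidean_space \<Rightarrow> complex)"
proof -
  obtain C where C: "C \<ge> 0"
      "\<And>x::'a. norm (gauss c x) \<le> C * (\<Prod>b\<in>Basis. inverse (1 + (x \<bullet> b)\<^sup>2))"
    using schwartz_decay [OF gauss_schwartz [OF assms]] by blast
  have int: "integrable lborel (\<lambda>x::'a. \<Prod>b\<in>Basis. inverse (1 + (x \<bullet> b)\<^sup>2))"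
    using nn_integral_prod_inverse_finite
    by (intro integrableI_nonneg AE_I2 prod_nonneg) auto
  have meas: "gauss c \<in> borel_measurable (lborel :: 'a measure)"
    unfolding gauss_def [abs_def] by measurable
  show ?thesis
    by (rule Bochner_Integration.integrable_bound [OF integrable_mult_right [OF int, of C] meas])
      (use C in \<open>auto intro!: order_trans [OF C(2)]\<close>)
qed

section \<open>The Dirac distribution\<close>

abbreviation dirac :: "('a::euclidean_space \<Rightarrow> complex) \<Rightarrow> complex" where
  "dirac \<equiv> (\<lambda>f. f 0)"

text \<open>Every Schwartz function lies in the subbasic set of radius 1 around itself.\<close>

lemma topspace_schwartz_topology: "topspace schwartz_topology = schwartz"
proof (intro equalityI subsetI)
  fix f :: "'a \<Rightarrow> complex"
  assume f: "f \<in> schwartz"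
  let ?N = "{g \<in> schwartz. schwartz_seminorm 0 [] (\<lambda>x. g x - f x) < 1}"
  have "openin schwartz_topology ?N"
    unfolding schwartz_topology_def using f
    by (intro topology_generated_by_Basis CollectI exI conjI refl) auto
  moreover have "f \<in> ?N"
    using f by (simp add: schwartz_seminorm_def)
  ultimately show "f \<in> topspace schwartz_topology"
    using openin_subset by blast
qed (auto simp: schwartz_topology_def)

text \<open>A real \<open>SUP\<close> dominates the values only when they are bounded above;
  boundedness of \<open>f\<close> and \<open>g\<close> provides this.\<close>

lemma norm_le_schwartz_seminorm:
  assumes "f \<in> schwartz" "g \<in> schwartz"
  shows "norm (f x - g x) \<le> schwartz_seminorm 0 [] (\<lambda>x. f x - g x)"
proof -
  obtain A B where AB: "\<And>x. norm (f x) \<le> A" "\<And>x. norm (g x) \<le> B"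
    using schwartz_pow_times_bounded [OF assms(1), of 0]
      schwartz_pow_times_bounded [OF assms(2), of 0] by auto
  have "norm (f x - g x) \<le> A + B" for x
    using norm_triangle_ineq4 [of "f x" "g x"] AB [of x] by linarith
  then have "bdd_above (range (\<lambda>x. norm (f x - g x)))"
    by (intro bdd_aboveI [where M = "A + B"]) auto
  then show ?thesis
    unfolding schwartz_seminorm_def by (auto intro: cSUP_upper)
qed

lemma dirac_tempered: "dirac \<in> tempered_distributions"
proof -
  have "continuous_map schwartz_topology euclidean (dirac :: ('a \<Rightarrow> complex) \<Rightarrow> complex)"
    unfolding continuous_map_def topspace_schwartz_topology
  proof (intro conjI allI impI)
    fix U :: "complex set"
    assume "openin euclidean U"
    then have U: "open U"
      by simp
    show "openin schwartz_topology {f \<in> schwartz. (f :: 'a \<Rightarrow> complex) 0 \<in> U}"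
    \<comment> \<open>Around each \<open>f\<close> the preimage contains a subbasic set of the sup
      seminorm, with the radius \<open>e\<close> of a ball around \<open>f 0\<close> inside
      \<open>U\<close>.\<close>
    proof (subst openin_subopen, intro ballI)
      fix f :: "'a \<Rightarrow> complex"
      assume "f \<in> {f \<in> schwartz. f 0 \<in> U}"
      then have f: "f \<in> schwartz" "f 0 \<in> U"
        by auto
      then obtain e where e: "e > 0" "ball (f 0) e \<subseteq> U"
        using U openE by blast
      let ?N = "{g \<in> schwartz. schwartz_seminorm 0 [] (\<lambda>x. g x - f x) < e}"
      have "openin schwartz_topology ?N"
        unfolding schwartz_topology_def using f e
        by (intro topology_generated_by_Basis CollectI exI conjI refl) auto
      moreover have "f \<in> ?N"
        using f e by (simp add: schwartz_seminorm_def)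
      moreover have "?N \<subseteq> {f \<in> schwartz. f 0 \<in> U}"
      proof clarify
        fix g assume g: "g \<in> schwartz" "schwartz_seminorm 0 [] (\<lambda>x. g x - f x) < e"
        have "norm (g 0 - f 0) < e"
          using norm_le_schwartz_seminorm [OF g(1) f(1), of 0] g(2) by linarith
        then show "g 0 \<in> U"
          using e(2) by (auto simp: dist_norm norm_minus_commute subset_iff)
      qed
      ultimately show "\<exists>T. openin schwartz_topology T \<and> f \<in> T \<and> T \<subseteq> {f \<in> schwartz. f 0 \<in> U}"
        by blast
    qed
  qed auto
  then show ?thesis
    by (simp add: tempered_distributions_def)
qed

lemma dirac_W_FLinf_L1:
  assumes "\<Phi> \<in> schwartz"
  shows "dirac \<in> W_FLinf_L1 (\<Phi> :: 'a::euclidean_space \<Rightarrow> complex)"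
proof -
  obtain C where C: "C \<ge> 0"
      "\<And>x. norm (\<Phi> x) \<le> C * (\<Prod>b\<in>Basis. inverse (1 + (x \<bullet> b)\<^sup>2))"
    using schwartz_decay [OF assms] by blast
  have "(\<integral>\<^sup>+ z. (SUP \<zeta>. ennreal (norm (STFT \<Phi> dirac z \<zeta>))) \<partial>lborel)
      \<le> (\<integral>\<^sup>+ z. ennreal C * ennreal (\<Prod>b\<in>Basis. inverse (1 + ((z::'a) \<bullet> b)\<^sup>2)) \<partial>lborel)"
  proof (intro nn_integral_mono SUP_least)
    fix z \<zeta> :: 'a
    \<comment> \<open>At \<open>t = 0\<close> the phase is 1, leaving
      \<open>cnj (\<Phi> (- z))\<close>, and the weight is even in \<open>z\<close>. The bound does
      not depend on \<open>\<zeta>\<close>, so it passes to the supremum.\<close>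
    have "norm (STFT \<Phi> dirac z \<zeta>) \<le> C * (\<Prod>b\<in>Basis. inverse (1 + (z \<bullet> b)\<^sup>2))"
      using C(2) [of "- z"] by (simp add: STFT_def)
    then show "ennreal (norm (STFT \<Phi> dirac z \<zeta>))
        \<le> ennreal C * ennreal (\<Prod>b\<in>Basis. inverse (1 + (z \<bullet> b)\<^sup>2))"
      using C(1) by (subst ennreal_mult' [symmetric]) (auto intro: ennreal_leI)
  qed
  also have "\<dots> = ennreal C * (\<integral>\<^sup>+ z. ennreal (\<Prod>b\<in>Basis. inverse (1 + ((z::'a) \<bullet> b)\<^sup>2)) \<partial>lborel)"
    by (rule nn_integral_cmult) measurable
  also have "\<dots> < \<infinity>"
    using nn_integral_prod_inverse_finite [where 'a = 'a] by (simp add: ennreal_mult_less_top)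
  finally show ?thesis
    by (simp add: W_FLinf_L1_def dirac_tempered)
qed

text \<open>At the origin of phase space the phase is 1. For \<open>\<tau> = 0\<close> the variable
  \<open>t\<close> enters only through \<open>f\<close>, reflected; for \<open>\<tau> = 1\<close>
  below it enters only through \<open>g\<close>.\<close>

lemma dual_pairing_Op0_dirac:
  "dual_pairing (Op 0 dirac f) g = cnj (g 0) * (LINT t|lborel. f (- t))"
proof -
  have "dual_pairing (Op 0 dirac f) g = cnj (LINT t|lborel. g 0 * cnj (f (- t)))"
    unfolding dual_pairing_Op by (simp add: dual_pairing_def tau_Wigner_def zero_prod_def)
  also have "\<dots> = cnj (g 0) * (LINT t|lborel. f (- t))"
    by (simp add: integral_cnj [symmetric])
  finally show ?thesis .
qed

lemma dual_pairing_Op1_dirac: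
  "dual_pairing (Op 1 dirac f) g = f 0 * (LINT t|lborel. cnj (g t))"
proof -
  have "dual_pairing (Op 1 dirac f) g = cnj (LINT t|lborel. g t * cnj (f 0))"
    unfolding dual_pairing_Op by (simp add: dual_pairing_def tau_Wigner_def zero_prod_def)
  also have "\<dots> = f 0 * (LINT t|lborel. cnj (g t))"
    by (simp add: integral_cnj [symmetric])
  finally show ?thesis .
qed

section \<open>Norms of Gaussians\<close>

text \<open>Reduces \<open>L2_norm\<close> of Gaussians to integrals of Gaussians.\<close>

lemma norm_gauss_square: "(norm (gauss c x))\<^sup>2 = norm (gauss (2 * c) x)"
  by (simp add: gauss_def exp_add [symmetric] power2_eq_square)

lemma gauss_L2_fun:
  assumes "c > 0"
  shows "gauss c \<in> L2_fun"
proof -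
  have "integrable lborel (\<lambda>x::'a. norm (gauss (2 * c) x))"
    using assms by (intro integrable_norm gauss_integrable) auto
  moreover have "gauss c \<in> borel_measurable (lborel :: 'a measure)"
    unfolding gauss_def [abs_def] by measurable
  ultimately show ?thesis
    by (simp add: L2_fun_def norm_gauss_square)
qed

text \<open>A nonnegative integrable function with zero integral vanishes almost everywhere, whereas
  the exponential vanishes nowhere and Lebesgue measure is not null.\<close>

lemma integral_gauss_nonzero:
  assumes "c > 0"
  shows "(LINT x|lborel. gauss c x) \<noteq> 0"
proof
  assume "(LINT x|lborel. gauss c (x::'a)) = 0"
  then have "(LINT x|lborel. exp (- c * ((x::'a) \<bullet> x))) = 0"
    unfolding gauss_def integral_complex_of_real by simp
  moreover have "integrable lborel (\<lambda>x::'a. exp (- c * (x \<bullet> x)))"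
    using integrable_norm [OF gauss_integrable [OF assms]] by (simp add: gauss_def)
  ultimately have "AE x in (lborel :: 'a measure). exp (- c * (x \<bullet> x)) = 0"
    by (subst (asm) integral_nonneg_eq_0_iff_AE) auto
  then show False
    by (simp add: ae_filter_eq_bot_iff)
qed

text \<open>Dominated convergence with majorant \<open>gauss 1\<close>. The index
  \<open>Suc n\<close> keeps the parameter at least 1.\<close>

lemma L2_norm_gauss_tendsto_0:
  "(\<lambda>n. L2_norm (gauss (real (Suc n)) :: 'a::euclidean_space \<Rightarrow> complex)) \<longlonglongrightarrow> 0"
proof -
  have "(\<lambda>n. LINT x|lborel. norm (gauss (2 * real (Suc n)) (x::'a))) \<longlonglongrightarrow> (LINT x|(lborel :: 'a measure). 0)"
  proof (rule integral_dominated_convergence [where w = "\<lambda>x::'a. norm (gauss 1 x)"])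
    show "AE x in (lborel :: 'a measure). (\<lambda>n. norm (gauss (2 * real (Suc n)) x)) \<longlonglongrightarrow> 0"
      \<comment> \<open>All the Gaussians equal 1 at the origin, which is a null set; elsewhere they
        form a geometric sequence of ratio below 1.\<close>
      using AE_lborel_singleton [of 0]
    proof eventually_elim
      case (elim x)
      then have "exp (- 2 * (x \<bullet> x)) < 1"
        by simp
      then have "(\<lambda>n. exp (- 2 * (x \<bullet> x)) ^ Suc n) \<longlonglongrightarrow> 0"
        by (intro LIMSEQ_Suc LIMSEQ_realpow_zero) auto
      moreover have "exp (- 2 * (x \<bullet> x)) ^ Suc n = norm (gauss (2 * real (Suc n)) x)" for n
        unfolding exp_of_nat_mult [symmetric] by (simp add: gauss_def algebra_simps)
      ultimately show ?case
        by (simp only:)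
    qed
    show "AE x in (lborel :: 'a measure). norm (norm (gauss (2 * real (Suc n)) x)) \<le> norm (gauss 1 x)"
      for n
    proof (rule AE_I2)
      fix x :: 'a
      have "- (2 * real (Suc n)) * (x \<bullet> x) \<le> - 1 * (x \<bullet> x)"
        by (intro mult_right_mono) auto
      then show "norm (norm (gauss (2 * real (Suc n)) x)) \<le> norm (gauss 1 x)"
        unfolding gauss_def norm_of_real abs_exp_cancel real_norm_def exp_le_cancel_iff .
    qed
    show "integrable lborel (\<lambda>x::'a. norm (gauss 1 x))"
      by (intro integrable_norm gauss_integrable) auto
  qed (auto simp: gauss_def [abs_def])
  then have "(\<lambda>n. sqrt (LINT x|lborel. norm (gauss (2 * real (Suc n)) (x::'a)))) \<longlonglongrightarrow> sqrt 0"
    by (intro tendsto_real_sqrt) simp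
  then show ?thesis
    by (simp add: L2_norm_def norm_gauss_square)
qed

section \<open>Bounded operators and their forms\<close>

text \<open>The discriminant criterion behind the Cauchy-Schwarz inequality.\<close>

lemma quadratic_nonneg_imp_square_le:
  fixes a b c :: real
  assumes quadratic: "\<And>t. 0 \<le> a + 2 * t * b + t\<^sup>2 * c" and nonneg: "a \<ge> 0" "c \<ge> 0"
  shows "b\<^sup>2 \<le> a * c"
proof (cases "c = 0")
  case True
  have "b = 0"
  proof (rule ccontr)
    assume "b \<noteq> 0"
    \<comment> \<open>With \<open>c = 0\<close> this \<open>t\<close> gives the polynomial the value
      -1.\<close>
    with quadratic [of "- (a + 1) / (2 * b)"] True nonneg(1) show False
      by (simp add: field_simps)
  qed
  with True show ?thesis
    by simp
next
  case False
  \<comment> \<open>The point \<open>- b / c\<close> minimises the quadratic.\<close>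
  have "0 \<le> c * (a + 2 * (- b / c) * b + (- b / c)\<^sup>2 * c)"
    using quadratic nonneg(2) by (intro mult_nonneg_nonneg)
  also have "\<dots> = a * c - b\<^sup>2"
    using False by (simp add: power2_eq_square algebra_simps)
  finally show ?thesis
    by simp
qed

text \<open>The discriminant criterion is applied to the integral of the square of
  \<open>norm (f x) + t * norm (g x)\<close>, which keeps everything real.\<close>

lemma L2_Cauchy_Schwarz:
  assumes "f \<in> L2_fun" "g \<in> L2_fun"
  shows "norm (LINT x|lborel. f x * cnj (g x)) \<le> L2_norm f * L2_norm g"
proof -
  have [measurable]: "f \<in> borel_measurable borel" "g \<in> borel_measurable borel"
    and f: "integrable lborel (\<lambda>x. (norm (f x))\<^sup>2)" and g: "integrable lborel (\<lambda>x. (norm (g x))\<^sup>2)"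
    using assms by (auto simp: L2_fun_def)
  let ?I = "LINT x|lborel. norm (f x) * norm (g x)"
  let ?F = "LINT x|lborel. (norm (f x))\<^sup>2" and ?G = "LINT x|lborel. (norm (g x))\<^sup>2"
  have int: "integrable lborel (\<lambda>x. norm (f x) * norm (g x))"
  proof (rule Bochner_Integration.integrable_bound [OF Bochner_Integration.integrable_add [OF f g]])
    show "AE x in lborel. norm (norm (f x) * norm (g x)) \<le> norm ((norm (f x))\<^sup>2 + (norm (g x))\<^sup>2)"
    proof (intro AE_I2)
      fix x
      have "0 \<le> norm (f x) * norm (g x)"
        by simp
      moreover have "2 * norm (f x) * norm (g x) \<le> (norm (f x))\<^sup>2 + (norm (g x))\<^sup>2"
        by (rule sum_squares_bound)
      ultimately show "norm (norm (f x) * norm (g x)) \<le> norm ((norm (f x))\<^sup>2 + (norm (g x))\<^sup>2)"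
        unfolding real_norm_def by linarith
    qed
  qed measurable
  have pos: "?F \<ge> 0" "?G \<ge> 0"
    by (auto intro!: integral_nonneg_AE)
  have quadratic: "0 \<le> ?F + 2 * t * ?I + t\<^sup>2 * ?G" for t
  proof -
    have "0 \<le> (LINT x|lborel. (norm (f x) + t * norm (g x))\<^sup>2)"
      by (intro integral_nonneg_AE) auto
    also have "\<dots> = (LINT x|lborel. (norm (f x))\<^sup>2 + 2 * t * (norm (f x) * norm (g x)) + t\<^sup>2 * (norm (g x))\<^sup>2)"
      by (intro Bochner_Integration.integral_cong) (auto simp: power2_eq_square algebra_simps)
    also have "\<dots> = ?F + 2 * t * ?I + t\<^sup>2 * ?G"
      using f g int by simp
    finally show ?thesis .
  qed
  have "?I\<^sup>2 \<le> ?F * ?G"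
    using quadratic pos by (rule quadratic_nonneg_imp_square_le)
  then have "?I \<le> L2_norm f * L2_norm g"
    unfolding L2_norm_def real_sqrt_mult [symmetric] by (rule real_le_rsqrt)
  moreover have "norm (LINT x|lborel. f x * cnj (g x)) \<le> ?I"
    using integral_norm_bound [of lborel "\<lambda>x. f x * cnj (g x)"] by (simp add: norm_mult)
  ultimately show ?thesis
    by linarith
qed

text \<open>Eliminates the extension \<open>T\<close>, leaving a bound that explicit functions can
  violate. The arguments lie in both classes since the pairing identity holds on
  \<open>schwartz\<close> and the norm bound on \<open>L2_fun\<close>.\<close>

lemma bounded_on_L2_form_bound:
  assumes "bounded_on_L2 A"
  shows "\<exists>C. \<forall>f \<in> schwartz \<inter> L2_fun. \<forall>g \<in> schwartz \<inter> L2_fun.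
           norm (dual_pairing (A f) g) \<le> C * L2_norm f * L2_norm g"
proof -
  obtain T C where T: "\<And>f. f \<in> L2_fun \<Longrightarrow> T f \<in> L2_fun"
      "\<And>f. f \<in> L2_fun \<Longrightarrow> L2_norm (T f) \<le> C * L2_norm f"
      "\<And>f g. f \<in> schwartz \<Longrightarrow> g \<in> schwartz
        \<Longrightarrow> dual_pairing (A f) g = (LINT x|lborel. T f x * cnj (g x))"
    using assms unfolding bounded_on_L2_def bounded_L2_operator_def by blast
  have "norm (dual_pairing (A f) g) \<le> C * L2_norm f * L2_norm g"
    if "f \<in> schwartz \<inter> L2_fun" "g \<in> schwartz \<inter> L2_fun" for f g
  proof -
    have "norm (dual_pairing (A f) g) \<le> L2_norm (T f) * L2_norm g"
      using that T L2_Cauchy_Schwarz [of "T f" g] by simp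
    also have "\<dots> \<le> C * L2_norm f * L2_norm g"
      using that T by (intro mult_right_mono) (auto simp: L2_norm_def)
    finally show ?thesis .
  qed
  then show ?thesis
    by blast
qed

text \<open>With \<open>f\<close> fixed as \<open>gauss 1\<close> and \<open>g\<close> running
  through narrowing Gaussians, the form stays at the nonzero integral of \<open>gauss 1\<close>
  because \<open>g 0 = 1\<close>, while its supposed bound tends to 0.\<close>

lemma Op0_dirac_not_bounded_on_L2:
  "\<not> bounded_on_L2 (Op 0 (dirac :: ('a::euclidean_space \<times> 'a \<Rightarrow> complex) \<Rightarrow> complex))"
proof
  assume "bounded_on_L2 (Op 0 (dirac :: ('a \<times> 'a \<Rightarrow> complex) \<Rightarrow> complex))"
  then obtain C where C: "\<forall>f \<in> schwartz \<inter> L2_fun. \<forall>g \<in> schwartz \<inter> L2_fun.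
      norm (dual_pairing (Op 0 (dirac :: ('a \<times> 'a \<Rightarrow> complex) \<Rightarrow> complex) f) g)
        \<le> C * L2_norm f * L2_norm g"
    using bounded_on_L2_form_bound by blast
  let ?I = "LINT x|lborel. gauss 1 (x::'a)" and ?N = "L2_norm (gauss 1 :: 'a \<Rightarrow> complex)"
  have "norm ?I \<le> C * ?N * L2_norm (gauss (real (Suc n)) :: 'a \<Rightarrow> complex)" for n
    using C [rule_format, of "gauss 1" "gauss (real (Suc n))"]
    by (simp add: dual_pairing_Op0_dirac gauss_schwartz gauss_L2_fun)
  moreover have "(\<lambda>n. C * ?N * L2_norm (gauss (real (Suc n)) :: 'a \<Rightarrow> complex)) \<longlonglongrightarrow> C * ?N * 0"
    by (intro tendsto_intros L2_norm_gauss_tendsto_0)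
  ultimately have "norm ?I \<le> C * ?N * 0"
    by (intro LIMSEQ_le_const) auto
  then show False
    using integral_gauss_nonzero [of 1, where ?'a = 'a] by simp
qed

text \<open>The same argument with the roles exchanged: the point value is now taken of
  \<open>f\<close>, so \<open>f\<close> narrows and \<open>g\<close> is fixed.\<close>

lemma Op1_dirac_not_bounded_on_L2:
  "\<not> bounded_on_L2 (Op 1 (dirac :: ('a::euclidean_space \<times> 'a \<Rightarrow> complex) \<Rightarrow> complex))"
proof
  assume "bounded_on_L2 (Op 1 (dirac :: ('a \<times> 'a \<Rightarrow> complex) \<Rightarrow> complex))"
  then obtain C where C: "\<forall>f \<in> schwartz \<inter> L2_fun. \<forall>g \<in> schwartz \<inter> L2_fun.
      norm (dual_pairing (Op 1 (dirac :: ('a \<times> 'a \<Rightarrow> complex) \<Rightarrow> complex) f) g)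
        \<le> C * L2_norm f * L2_norm g"
    using bounded_on_L2_form_bound by blast
  let ?I = "LINT x|lborel. gauss 1 (x::'a)" and ?N = "L2_norm (gauss 1 :: 'a \<Rightarrow> complex)"
  have "norm ?I \<le> C * L2_norm (gauss (real (Suc n)) :: 'a \<Rightarrow> complex) * ?N" for n
    using C [rule_format, of "gauss (real (Suc n))" "gauss 1"]
    by (simp add: dual_pairing_Op1_dirac gauss_schwartz gauss_L2_fun)
  moreover have "(\<lambda>n. C * L2_norm (gauss (real (Suc n)) :: 'a \<Rightarrow> complex) * ?N) \<longlonglongrightarrow> C * 0 * ?N"
    by (intro tendsto_intros L2_norm_gauss_tendsto_0)
  ultimately have "norm ?I \<le> C * 0 * ?N"
    by (intro LIMSEQ_le_const) auto
  then show False
    using integral_gauss_nonzero [of 1, where ?'a = 'a] by simp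
qed

theorem proposition4p4:
  shows "\<exists>a :: ((real ^ 'n) \<times> (real ^ 'n) \<Rightarrow> complex) \<Rightarrow> complex.
    (\<forall>\<Phi> \<in> schwartz. \<Phi> \<noteq> (\<lambda>_. 0) \<longrightarrow> a \<in> W_FLinf_L1 \<Phi>) \<and>
    \<not> bounded_on_L2 (Op 0 a) \<and> \<not> bounded_on_L2 (Op 1 a)"
  using dirac_W_FLinf_L1 Op0_dirac_not_bounded_on_L2 Op1_dirac_not_bounded_on_L2
  by (intro exI [of _ dirac]) blast

end
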